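(* Let $N$ be a 2-step nilpotent Lie group equipped with a left-invariant metric. If $N$ admits a left-invariant symplectic structure, then $N$ admits a non-trivial left-invariant Lorentz force of type II; that is, there is a nonzero skew-symmetric map $F:\mathfrak{n}\to\mathfrak{n}$ on its Lie algebra with $F(\mathfrak{v})\subseteq\mathfrak{z}$ and $F(\mathfrak{z})\subseteq\mathfrak{v}$ such that the 2-form $\omega(X,Y)=\langle F(X),Y\rangle$ is closed.
   Context: All Lie groups and Lie algebras are real and finite-dimensional. A Lie group is 2-step nilpotent if its Lie algebra $\mathfrak{n}$ is non-abelian and satisfies $[[U,V],W]=0$ for all $U,V,W$. A left-invariant metric is identified with an inner product $\langle\,,\,\rangle$ on $\mathfrak{n}$; $\mathfrak{z}$ is the center of $\mathfrak{n}$ and $\mathfrak{v}=\mathfrak{z}^{\perp}$, so $\mathfrak{n}=\mathfrak{v}\oplus\mathfrak{z}$. Left-invariant 2-forms on $N$ are identified with 2-forms on $\mathfrak{n}$. A 2-form $\omega$ on $\mathfrak{n}$ is closed if $\omega([U,V],W)+\omega([V,W],U)+\omega([W,U],V)=0$ for all $U,V,W\in\mathfrak{n}$; it is symplectic if it is closed and non-degenerate. A Lorentz force is a skew-symmetric endomorphism $F$ of $\mathfrak{n}$ whose associated 2-form $\omega(X,Y)=\langle F(X),Y\rangle$ is closed; it is of type II if $F(\mathfrak{v})\subseteq\mathfrak{z}$ and $F(\mathfrak{z})\subseteq\mathfrak{v}$. *)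

theory Defs
  imports "HOL-Analysis.Analysis"
begin

text \<open>
  A Lie group with a left-invariant metric enters only through its Lie algebra and an inner
  product on it.  The Lie algebra is a type of class \<open>euclidean_space\<close>, whose inner
  product \<open>\<bullet>\<close> is the metric, together with a bracket \<open>br\<close>.
\<close>

definition lie_bracket :: "('a::real_vector \<Rightarrow> 'a \<Rightarrow> 'a) \<Rightarrow> bool" where
  "lie_bracket br \<longleftrightarrow>
     bilinear br \<and>
     (\<forall>X. br X X = 0) \<and>
     (\<forall>X Y Z. br X (br Y Z) + br Y (br Z X) + br Z (br X Y) = 0)"

definition two_step_nilpotent :: "('a::real_vector \<Rightarrow> 'a \<Rightarrow> 'a) \<Rightarrow> bool" where
  "two_step_nilpotent br \<longleftrightarrow>
     lie_bracket br \<and>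
     (\<exists>U V. br U V \<noteq> 0) \<and>
     (\<forall>U V W. br (br U V) W = 0)"

definition lie_center :: "('a::real_vector \<Rightarrow> 'a \<Rightarrow> 'a) \<Rightarrow> 'a set" where
  "lie_center br = {Z. \<forall>X. br Z X = 0}"

definition two_form :: "('a::real_vector \<Rightarrow> 'a \<Rightarrow> real) \<Rightarrow> bool" where
  "two_form \<omega> \<longleftrightarrow> bilinear \<omega> \<and> (\<forall>X. \<omega> X X = 0)"

text \<open>
  Closedness of the corresponding left-invariant form; the expression is the exterior
  derivative up to sign.
\<close>

definition closed_form ::
    "('a::real_vector \<Rightarrow> 'a \<Rightarrow> 'a) \<Rightarrow> ('a \<Rightarrow> 'a \<Rightarrow> real) \<Rightarrow> bool" where
  "closed_form br \<omega> \<longleftrightarrow>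
     (\<forall>U V W. \<omega> (br U V) W + \<omega> (br V W) U + \<omega> (br W U) V = 0)"

definition nondegenerate_form :: "('a::real_vector \<Rightarrow> 'a \<Rightarrow> real) \<Rightarrow> bool" where
  "nondegenerate_form \<omega> \<longleftrightarrow> (\<forall>X. (\<forall>Y. \<omega> X Y = 0) \<longrightarrow> X = 0)"

definition symplectic_form ::
    "('a::real_vector \<Rightarrow> 'a \<Rightarrow> 'a) \<Rightarrow> ('a \<Rightarrow> 'a \<Rightarrow> real) \<Rightarrow> bool" where
  "symplectic_form br \<omega> \<longleftrightarrow>
     two_form \<omega> \<and> closed_form br \<omega> \<and> nondegenerate_form \<omega>"

definition skew_symmetric :: "('a::real_inner \<Rightarrow> 'a) \<Rightarrow> bool" where
  "skew_symmetric F \<longleftrightarrow> linear F \<and> (\<forall>X Y. F X \<bullet> Y = - (X \<bullet> F Y))"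

definition lorentz_force ::
    "('a::real_inner \<Rightarrow> 'a \<Rightarrow> 'a) \<Rightarrow> ('a \<Rightarrow> 'a) \<Rightarrow> bool" where
  "lorentz_force br F \<longleftrightarrow> skew_symmetric F \<and> closed_form br (\<lambda>X Y. F X \<bullet> Y)"

definition type_II ::
    "('a::euclidean_space \<Rightarrow> 'a \<Rightarrow> 'a) \<Rightarrow> ('a \<Rightarrow> 'a) \<Rightarrow> bool" where
  "type_II br F \<longleftrightarrow>
     F ` orthogonal_comp (lie_center br) \<subseteq> lie_center br \<and>
     F ` lie_center br \<subseteq> orthogonal_comp (lie_center br)"

end

theory Submission
  imports Defs
begin

text \<open>
  Let \<open>\<zz>\<close> be the center and \<open>\<vv>\<close> its orthogonal complement, and write \<open>X\<^sub>\<vv>\<close> for the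
  \<open>\<vv>\<close>-component of \<open>X\<close>.  Of the symplectic form \<open>\<omega>\<close> keep only the mixed part \<open>\<eta>\<close>, the
  component pairing \<open>\<vv>\<close> with \<open>\<zz>\<close>.  The endomorphism \<open>F\<close> with \<open>\<langle>F X, Y\<rangle> = \<eta>(X, Y)\<close> is then
  skew-symmetric and exchanges \<open>\<vv>\<close> and \<open>\<zz>\<close>.

  The mixed part is still closed.  Since the algebra is 2-step nilpotent, \<open>[U, V]\<close> is central, so
  \<open>\<eta>([U, V], W) = \<omega>([U, V], W\<^sub>\<vv>)\<close>; and since brackets ignore central summands,
  \<open>[U, V] = [U\<^sub>\<vv>, V\<^sub>\<vv>]\<close>.  The closedness condition of \<open>\<eta>\<close> at \<open>(U, V, W)\<close> is therefore that
  of \<open>\<omega>\<close> at \<open>(U\<^sub>\<vv>, V\<^sub>\<vv>, W\<^sub>\<vv>)\<close> (\<open>closed_mixed_part\<close>).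

  The mixed part is also nonzero.  Closedness at \<open>(U, V, Z)\<close> with \<open>Z\<close> central reads
  \<open>\<omega>([U, V], Z) = 0\<close> (\<open>closed_form_bracket_center\<close>).  A nonzero bracket thus pairs
  trivially with \<open>\<zz>\<close>, and by non-degeneracy it must pair nontrivially with some vector of \<open>\<vv>\<close>.
\<close>

lemma linear_orthogonal_projection_exists:
  fixes S :: "'a::euclidean_space set"
  assumes "subspace S"
  obtains P where "linear P" "\<And>X. P X \<in> S" "\<And>X. X - P X \<in> orthogonal_comp S"
proof -
  obtain B where B: "B \<subseteq> S" "pairwise orthogonal B" "\<And>b. b \<in> B \<Longrightarrow> norm b = 1"
    and ind: "independent B" and sp: "span B = S"
    using orthonormal_basis_subspace[OF assms] by metis
  have fin: "finite B" using ind by (rule independent_imp_finite)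
  define P where "P X = (\<Sum>b\<in>B. (X \<bullet> b) *\<^sub>R b)" for X
  show thesis
  proof
    show "linear P"
      unfolding P_def
      by (intro linearI)
        (simp_all add: inner_add_left scaleR_add_left sum.distrib scaleR_sum_right)
    show "P X \<in> S" for X
      unfolding P_def using B(1) assms by (intro subspace_sum subspace_scale) auto
    show "X - P X \<in> orthogonal_comp S" for X
    proof -
      have "orthogonal (X - P X) c" if c: "c \<in> B" for c
      proof -
        have "P X \<bullet> c = (\<Sum>b\<in>B. if b = c then X \<bullet> b else 0)"
          unfolding P_def inner_sum_left
          using B(2,3) c
          by (intro sum.cong) (auto simp: pairwise_def orthogonal_def dot_square_norm)
        then show ?thesis
          using fin c by (simp add: orthogonal_def inner_diff_left)
      qed
      then have "orthogonal (X - P X) Y" if "Y \<in> S" for Y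
        using that sp orthogonal_to_span by blast
      then show ?thesis
        by (auto simp: orthogonal_comp_def orthogonal_commute)
    qed
  qed
qed

lemma bilinear_form_representation:
  fixes \<eta> :: "'a::euclidean_space \<Rightarrow> 'a \<Rightarrow> real"
  assumes "bilinear \<eta>"
  obtains F where "linear F" "\<And>X Y. F X \<bullet> Y = \<eta> X Y"
proof
  \<comment> \<open>For a linear functional \<open>f\<close>, the vector \<open>adjoint f 1\<close> is its Riesz representative.\<close>
  define F where "F X = adjoint (\<eta> X) 1" for X
  show rep: "F X \<bullet> Y = \<eta> X Y" for X Y
    using adjoint_works[of "\<eta> X" Y 1] assms
    by (simp add: F_def bilinear_def inner_commute)
  show "linear F"
  proof (rule linearI)
    show "F (X + Y) = F X + F Y" for X Y
      by (rule vector_eq_rdot[THEN iffD1])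
        (simp add: rep inner_add_left bilinear_ladd[OF assms])
    show "F (c *\<^sub>R X) = c *\<^sub>R F X" for c X
      by (rule vector_eq_rdot[THEN iffD1])
        (simp add: rep bilinear_lmul[OF assms])
  qed
qed

lemma alternating_bilinear_antisym:
  assumes bil: "bilinear h" and alt: "\<And>X. h X X = 0"
  shows "h X Y = - h Y X"
proof -
  have "h (X + Y) (X + Y) = h X X + h X Y + (h Y X + h Y Y)"
    by (simp only: bilinear_ladd[OF bil] bilinear_radd[OF bil] add_ac)
  then show ?thesis
    by (simp add: alt eq_neg_iff_add_eq_0)
qed

lemma two_form_antisym:
  assumes "two_form \<omega>"
  shows "\<omega> X Y = - \<omega> Y X"
  using assms alternating_bilinear_antisym by (auto simp: two_form_def)

lemma lie_bracket_antisym: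
  assumes "lie_bracket br"
  shows "br X Y = - br Y X"
  using assms alternating_bilinear_antisym by (auto simp: lie_bracket_def)

lemma subspace_lie_center:
  assumes "lie_bracket br"
  shows "subspace (lie_center br)"
proof -
  have bil: "bilinear br"
    using assms by (simp add: lie_bracket_def)
  show ?thesis
    by (auto simp: subspace_def lie_center_def bilinear_lzero[OF bil] bilinear_ladd[OF bil]
        bilinear_lmul[OF bil])
qed

lemma br_lie_center:
  assumes "lie_bracket br" and "Z \<in> lie_center br"
  shows "br Z X = 0" and "br X Z = 0"
  using assms lie_bracket_antisym[OF assms(1), of X Z] by (auto simp: lie_center_def)

lemma br_diff_lie_center:
  assumes "lie_bracket br" and "Z \<in> lie_center br" and "Z' \<in> lie_center br"
  shows "br (X - Z) (Y - Z') = br X Y"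
proof -
  have bil: "bilinear br"
    using assms by (simp add: lie_bracket_def)
  show ?thesis
    by (simp add: bilinear_lsub[OF bil] bilinear_rsub[OF bil] br_lie_center[OF assms(1)] assms)
qed

lemma closed_form_bracket_center:
  assumes "lie_bracket br" and "two_form \<omega>" and "closed_form br \<omega>" and "Z \<in> lie_center br"
  shows "\<omega> (br U V) Z = 0"
proof -
  have "\<omega> (br U V) Z + \<omega> (br V Z) U + \<omega> (br Z U) V = 0"
    using assms(3) by (simp add: closed_form_def)
  moreover have "bilinear \<omega>"
    using assms(2) by (simp add: two_form_def)
  ultimately show ?thesis
    by (simp add: br_lie_center[OF assms(1,4)] bilinear_lzero)
qed

text \<open>
  Here \<open>P\<close> plays the role of the projection onto \<open>\<zz>\<close>, so that \<open>X - P X\<close> is the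
  \<open>\<vv>\<close>-component of \<open>X\<close>.
\<close>

definition mixed_part ::
    "('a::real_vector \<Rightarrow> 'a) \<Rightarrow> ('a \<Rightarrow> 'a \<Rightarrow> real) \<Rightarrow> 'a \<Rightarrow> 'a \<Rightarrow> real" where
  "mixed_part P \<omega> X Y = \<omega> (X - P X) (P Y) + \<omega> (P X) (Y - P Y)"

lemma two_form_mixed_part:
  assumes "linear P" and "two_form \<omega>"
  shows "two_form (mixed_part P \<omega>)"
proof -
  have bil: "bilinear \<omega>"
    using assms(2) by (simp add: two_form_def)
  note bil_simps = bilinear_ladd[OF bil] bilinear_radd[OF bil] bilinear_lsub[OF bil]
    bilinear_rsub[OF bil] bilinear_lmul[OF bil] bilinear_rmul[OF bil]
  have "bilinear (mixed_part P \<omega>)"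
    unfolding bilinear_def mixed_part_def
    by (auto intro!: linearI simp: linear_add[OF assms(1)] linear_scale[OF assms(1)] bil_simps
        algebra_simps)
  moreover have "mixed_part P \<omega> X X = 0" for X
    using two_form_antisym[OF assms(2), of "X - P X" "P X"] by (simp add: mixed_part_def)
  ultimately show ?thesis
    by (simp add: two_form_def)
qed

text \<open>
  Central vectors are fixed by \<open>P\<close>, hence \<open>\<eta>(Z, W) = \<omega>(Z, W - P W)\<close> for central \<open>Z\<close>; applied
  to \<open>Z = [U, V] = [U - P U, V - P V]\<close> this turns the closedness of the mixed part into that of
  \<open>\<omega>\<close> on the \<open>\<vv>\<close>-components.
\<close>

lemma closed_mixed_part:
  assumes two_step: "two_step_nilpotent br" and "two_form \<omega>" and closed: "closed_form br \<omega>"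
    and P_center: "\<And>X. P X \<in> lie_center br"
    and P_id: "\<And>Z. Z \<in> lie_center br \<Longrightarrow> P Z = Z"
  shows "closed_form br (mixed_part P \<omega>)"
proof -
  have lie: "lie_bracket br"
    using two_step by (simp add: two_step_nilpotent_def)
  have bil: "bilinear \<omega>"
    using assms(2) by (simp add: two_form_def)
  have reduce: "mixed_part P \<omega> (br U V) W = \<omega> (br (U - P U) (V - P V)) (W - P W)" for U V W
  proof -
    have "br U V \<in> lie_center br"
      using two_step by (simp add: two_step_nilpotent_def lie_center_def)
    then show ?thesis
      by (simp add: mixed_part_def P_id br_diff_lie_center[OF lie P_center P_center]
          bilinear_lzero[OF bil])
  qed
  show ?thesis
    using closed unfolding closed_form_def reduce by blast
qed

theorem lemma3p6:
  fixes br :: "'a::euclidean_space \<Rightarrow> 'a \<Rightarrow> 'a"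
  assumes "two_step_nilpotent br"
    and "\<exists>\<omega>. symplectic_form br \<omega>"
  shows "\<exists>F. F \<noteq> (\<lambda>X. 0) \<and> lorentz_force br F \<and> type_II br F"
proof -
  obtain \<omega> where two: "two_form \<omega>" and closed: "closed_form br \<omega>"
    and nondeg: "nondegenerate_form \<omega>"
    using assms(2) by (auto simp: symplectic_form_def)
  have bil: "bilinear \<omega>"
    using two by (simp add: two_form_def)
  have lie: "lie_bracket br"
    using assms(1) by (simp add: two_step_nilpotent_def)
  let ?\<zz> = "lie_center br"
  note sub = subspace_lie_center[OF lie]
  obtain P where P: "linear P" "\<And>X. P X \<in> ?\<zz>" "\<And>X. X - P X \<in> orthogonal_comp ?\<zz>"
    using linear_orthogonal_projection_exists[OF sub] by metis
  have disj: "X = 0" if "X \<in> ?\<zz>" "X \<in> orthogonal_comp ?\<zz>" for X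
    using that by (auto simp: orthogonal_comp_def orthogonal_def)
  have P_id: "P Z = Z" if "Z \<in> ?\<zz>" for Z
    using disj[of "Z - P Z"] P that subspace_diff[OF sub] by auto
  have P_zero: "P X = 0" if "X \<in> orthogonal_comp ?\<zz>" for X
    using disj[of "P X"] P(2) subspace_diff[OF subspace_orthogonal_comp that P(3)[of X]] by simp
  let ?\<eta> = "mixed_part P \<omega>"
  have \<eta>_two: "two_form ?\<eta>"
    using P(1) two by (rule two_form_mixed_part)
  then have \<eta>_bil: "bilinear ?\<eta>"
    by (simp add: two_form_def)
  obtain F where F: "linear F" "\<And>X Y. F X \<bullet> Y = ?\<eta> X Y"
    using bilinear_form_representation[OF \<eta>_bil] by metis

  have "lorentz_force br F"
    unfolding lorentz_force_def skew_symmetric_def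
  proof (intro conjI allI)
    show "F X \<bullet> Y = - (X \<bullet> F Y)" for X Y
      using two_form_antisym[OF \<eta>_two, of X Y] F(2) by (simp add: inner_commute[of X])
    show "closed_form br (\<lambda>X Y. F X \<bullet> Y)"
      unfolding F(2) using closed_mixed_part[OF assms(1) two closed P(2) P_id] .
  qed (rule F(1))

  moreover have "type_II br F"
    unfolding type_II_def
  proof (intro conjI image_subsetI)
    fix X assume "X \<in> orthogonal_comp ?\<zz>"
    then have "F X \<bullet> Y = 0" if "Y \<in> orthogonal_comp ?\<zz>" for Y
      using that by (simp add: F(2) mixed_part_def P_zero bilinear_lzero[OF bil]
          bilinear_rzero[OF bil])
    then have "F X \<in> orthogonal_comp (orthogonal_comp ?\<zz>)"
      by (auto simp: orthogonal_comp_def[of "orthogonal_comp _"] orthogonal_def inner_commute)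
    then show "F X \<in> ?\<zz>"
      by (simp add: orthogonal_comp_self[OF sub])
  next
    fix X assume "X \<in> ?\<zz>"
    then have "F X \<bullet> Y = 0" if "Y \<in> ?\<zz>" for Y
      using that by (simp add: F(2) mixed_part_def P_id bilinear_lzero[OF bil]
          bilinear_rzero[OF bil])
    then show "F X \<in> orthogonal_comp ?\<zz>"
      by (auto simp: orthogonal_comp_def orthogonal_def inner_commute)
  qed

  moreover have "F \<noteq> (\<lambda>X. 0)"
  proof
    assume F0: "F = (\<lambda>X. 0)"
    obtain U V where "br U V \<noteq> 0"
      using assms(1) by (auto simp: two_step_nilpotent_def)
    then obtain Y where Y: "\<omega> (br U V) Y \<noteq> 0"
      using nondeg by (auto simp: nondegenerate_form_def)
    have "br U V \<in> ?\<zz>"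
      using assms(1) by (simp add: two_step_nilpotent_def lie_center_def)
    then have "F (br U V) \<bullet> Y = \<omega> (br U V) (Y - P Y)"
      by (simp add: F(2) mixed_part_def P_id bilinear_lzero[OF bil])
    also have "\<dots> = \<omega> (br U V) Y"
      by (simp add: bilinear_rsub[OF bil] closed_form_bracket_center[OF lie two closed P(2)])
    finally show False
      using Y F0 by simp
  qed

  ultimately show ?thesis
    by blast
qed

end
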